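(* Let $R$ be a Noetherian ring and $I_1,\dots,I_r$ ideals of $R$. Then there exists $\alpha\in\mathbb{N}$ such that $$I_1^{n_1}\cdots I_r^{n_r}:_RJ^{\alpha|\mathbf{n}|}=I_1^{n_1}\cdots I_r^{n_r}:_RJ^{\alpha|\mathbf{n}|+1}$$ for all ideals $J$ of $R$ and all $\mathbf{n}=(n_1,\dots,n_r)\in\mathbb{N}^r$, where $|\mathbf{n}|=n_1+\cdots+n_r$. *)

theory Defs
  imports "HOL-Algebra.Ideal_Product" "HOL-Algebra.Ring_Divisibility"
begin

primrec ideal_pow :: "('a, 'b) ring_scheme \<Rightarrow> 'a set \<Rightarrow> nat \<Rightarrow> 'a set" where
  "ideal_pow R I 0 = carrier R"
| "ideal_pow R I (Suc k) = ideal_prod R I (ideal_pow R I k)"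

primrec ideal_prod_pows :: "('a, 'b) ring_scheme \<Rightarrow> (nat \<Rightarrow> 'a set) \<Rightarrow> (nat \<Rightarrow> nat) \<Rightarrow> nat \<Rightarrow> 'a set" where
  "ideal_prod_pows R I n 0 = carrier R"
| "ideal_prod_pows R I n (Suc r) = ideal_prod R (ideal_prod_pows R I n r) (ideal_pow R (I r) (n r))"

definition ideal_colon :: "('a, 'b) ring_scheme \<Rightarrow> 'a set \<Rightarrow> 'a set \<Rightarrow> 'a set" where
  "ideal_colon R I K = {x \<in> carrier R. \<forall>k \<in> K. x \<otimes>\<^bsub>R\<^esub> k \<in> I}"

end

theory Submission
  imports Defs "HOL-Library.List_Lexorder"
begin

text \<open>Write \<open>I\<^sup>n\<close> for the product of the powers and \<open>e\<^sub>i\<close> for the unit vectors. It suffices to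
  find \<open>c\<close>, independent of \<open>n\<close>, \<open>i\<close> and \<open>J\<close>, such that an element of \<open>I\<^sup>n\<close> which some power of
  \<open>J\<close> multiplies into the ideal with exponent \<open>n + e\<^sub>i\<close> is already multiplied into it by
  \<open>J\<^sup>c\<close>: climbing from \<open>0\<close> to \<open>n\<close> in \<open>|n|\<close> unit steps, each step costs \<open>c\<close> factors of \<open>J\<close>.

  Such a \<open>c\<close> comes from Noetherianity of the Rees algebra, the direct sum of all \<open>I\<^sup>n\<close>. A graded
  submodule \<open>A\<close> that is irreducible among graded submodules is primary with respect to \<open>R\<close>: every
  \<open>x\<close> in \<open>R\<close> is nilpotent or a nonzerodivisor modulo \<open>A\<close>, and a fixed power of the ideal of
  nilpotent elements kills everything modulo \<open>A\<close>. This gives \<open>c\<close> for irreducible \<open>A\<close>, and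
  Noetherian induction extends it to all \<open>A\<close>, in particular to the shifts of the Rees algebra
  by \<open>e\<^sub>i\<close>. The ascending chain condition for graded submodules follows from Dickson's lemma
  applied to ideals of leading coefficients with respect to a lexicographic monomial order.\<close>

section \<open>Ideals of commutative Noetherian rings\<close>

locale noetherian_cring = cring R + noetherian_ring R for R (structure)

text \<open>Negatives come from multiplying by the negative of one, and the second multiplication
  law from commutativity.\<close>

lemma (in cring) ideal_by_closure:
  assumes sub: "I \<subseteq> carrier R" and zero: "\<zero> \<in> I"
    and add: "\<And>a b. a \<in> I \<Longrightarrow> b \<in> I \<Longrightarrow> a \<oplus> b \<in> I"
    and mult: "\<And>a x. a \<in> I \<Longrightarrow> x \<in> carrier R \<Longrightarrow> x \<otimes> a \<in> I"
  shows "ideal I R"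
proof (rule idealI)
  show "ring R" by (rule ring_axioms)
  show "subgroup I (add_monoid R)"
  proof (rule add.subgroupI)
    fix a assume a: "a \<in> I"
    then have "\<ominus> a = (\<ominus> \<one>) \<otimes> a"
      using sub by (simp add: l_minus subset_eq)
    then show "\<ominus> a \<in> I"
      using mult[OF a, of "\<ominus> \<one>"] by simp
  qed (use sub zero add in auto)
  fix a x assume a: "a \<in> I" and x: "x \<in> carrier R"
  show "x \<otimes> a \<in> I" using mult[OF a x] .
  then show "a \<otimes> x \<in> I" using m_comm[of a x] a x sub by auto
qed

lemma ideal_zero_mem: "ideal I R \<Longrightarrow> \<zero>\<^bsub>R\<^esub> \<in> I"
  by (simp add: additive_subgroup.zero_closed ideal.axioms(1))

lemma ideal_add_mem: "ideal I R \<Longrightarrow> a \<in> I \<Longrightarrow> b \<in> I \<Longrightarrow> a \<oplus>\<^bsub>R\<^esub> b \<in> I"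
  by (simp add: additive_subgroup.a_closed ideal.axioms(1))

lemma ideal_minus_mem: "ideal I R \<Longrightarrow> a \<in> I \<Longrightarrow> b \<in> I \<Longrightarrow> a \<ominus>\<^bsub>R\<^esub> b \<in> I"
  by (simp add: a_minus_def additive_subgroup.a_closed additive_subgroup.a_inv_closed ideal.axioms)

text \<open>The elements that \<open>a\<close> multiplies into \<open>K\<close> form an ideal, so it
  is enough to test generators.\<close>

lemma (in cring) genideal_mult_mem:
  assumes "S \<subseteq> carrier R" "ideal K R" "a \<in> carrier R"
    and "\<And>s. s \<in> S \<Longrightarrow> a \<otimes> s \<in> K" and x: "x \<in> Idl S"
  shows "a \<otimes> x \<in> K"
proof -
  have "ideal {x \<in> carrier R. a \<otimes> x \<in> K} R"
  proof (rule ideal_by_closure)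
    fix y z assume "y \<in> {x \<in> carrier R. a \<otimes> x \<in> K}" "z \<in> carrier R"
    then show "z \<otimes> y \<in> {x \<in> carrier R. a \<otimes> x \<in> K}"
      using ideal.I_l_closed[OF assms(2), of "a \<otimes> y" z] assms(3) by (auto simp: m_lcomm)
  qed (use assms(2,3) ideal_zero_mem[OF assms(2)] in \<open>auto simp: r_distr ideal_add_mem\<close>)
  then have "Idl S \<subseteq> {x \<in> carrier R. a \<otimes> x \<in> K}"
    by (rule genideal_minimal) (use assms in auto)
  with x show ?thesis by auto
qed

text \<open>The sums of this shape already form an ideal containing all generators. It serves to
  split a leading term off a combination of monomials.\<close>

lemma (in cring) genideal_insert_mem:
  assumes "a \<in> carrier R" "S \<subseteq> carrier R" and x: "x \<in> Idl (insert a S)"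
  obtains c w where "c \<in> carrier R" "w \<in> Idl S" "x = c \<otimes> a \<oplus> w"
proof -
  let ?K = "{c \<otimes> a \<oplus> w | c w. c \<in> carrier R \<and> w \<in> Idl S}"
  have S: "ideal (Idl S) R" by (rule genideal_ideal[OF assms(2)])
  have carr: "w \<in> carrier R" if "w \<in> Idl S" for w using ideal.Icarr[OF S that] .
  have "ideal ?K R"
  proof (rule ideal_by_closure)
    show "?K \<subseteq> carrier R" using assms carr by auto
    show "\<zero> \<in> ?K" using assms ideal_zero_mem[OF S] by (auto intro!: exI[of _ \<zero>])
  next
    fix y z assume "y \<in> ?K" "z \<in> ?K"
    then obtain c w c' w' where *: "c \<in> carrier R" "w \<in> Idl S" "y = c \<otimes> a \<oplus> w"
      "c' \<in> carrier R" "w' \<in> Idl S" "z = c' \<otimes> a \<oplus> w'" by auto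
    then have "y \<oplus> z = (c \<oplus> c') \<otimes> a \<oplus> (w \<oplus> w')"
      using assms carr by (simp add: l_distr a_ac)
    then show "y \<oplus> z \<in> ?K" using * ideal_add_mem[OF S] by blast
  next
    fix y z assume "y \<in> ?K" and z: "z \<in> carrier R"
    then obtain c w where *: "c \<in> carrier R" "w \<in> Idl S" "y = c \<otimes> a \<oplus> w" by auto
    then have "z \<otimes> y = (z \<otimes> c) \<otimes> a \<oplus> (z \<otimes> w)"
      using assms carr z by (simp add: r_distr m_assoc)
    then show "z \<otimes> y \<in> ?K" using * ideal.I_l_closed[OF S _ z] z by blast
  qed
  then have "Idl (insert a S) \<subseteq> ?K"
  proof (rule genideal_minimal)
    have "a = \<one> \<otimes> a \<oplus> \<zero>" using assms by simp
    then have "a \<in> ?K" using ideal_zero_mem[OF S] by blast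
    moreover have "s \<in> ?K" if "s \<in> S" for s
    proof -
      have "s = \<zero> \<otimes> a \<oplus> s" using assms that by auto
      then show ?thesis using genideal_self[OF assms(2)] that by blast
    qed
    ultimately show "insert a S \<subseteq> ?K" by auto
  qed
  with x that show ?thesis by auto
qed

text \<open>The union of a chain of ideals belongs to the chain. A single stationary step suffices
  wherever a strictly increasing sequence is to be refuted.\<close>

lemma (in noetherian_cring) ideal_seq_stationary:
  assumes id: "\<And>k. ideal (H k) R" and mono: "\<And>k::nat. H k \<subseteq> H (Suc k)"
  shows "\<exists>k. H (Suc k) = H k"
proof -
  have m: "mono H" using mono by (simp add: mono_iff_le_Suc)
  have "\<Union>(range H) \<in> range H"
  proof (rule ideal_chain_is_trivial)
    show "subset.chain {I. ideal I R} (range H)"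
    proof -
      have "H i \<subseteq> H j \<or> H j \<subseteq> H i" for i j
        using monoD[OF m] nat_le_linear[of i j] by blast
      then show ?thesis unfolding subset_chain_def using id by blast
    qed
  qed auto
  then obtain k where "\<Union>(range H) = H k" by auto
  then show ?thesis using mono[of k] by blast
qed

section \<open>Powers of ideals\<close>

lemma (in cring) ideal_pow_ideal: "ideal J R \<Longrightarrow> ideal (ideal_pow R J k) R"
  by (induction k) (auto intro: oneideal ideal_prod_is_ideal)

lemma (in cring) ideal_pow_add:
  "ideal J R \<Longrightarrow> ideal_pow R J (a + b) = ideal_prod R (ideal_pow R J a) (ideal_pow R J b)"
proof (induction a)
  case 0
  then show ?case
    by (simp add: ideal_prod_commute[OF oneideal] ideal_prod_one ideal_pow_ideal)
next
  case (Suc a)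
  then show ?case by (simp add: ideal_prod_assoc ideal_pow_ideal)
qed

lemma (in cring) ideal_pow_antimono:
  "ideal J R \<Longrightarrow> a \<le> b \<Longrightarrow> ideal_pow R J b \<subseteq> ideal_pow R J a"
  using ideal_pow_add[of J a "b - a"] ideal_prod_inter[OF ideal_pow_ideal ideal_pow_ideal, of J J a "b - a"]
  by auto

lemma (in cring) nat_pow_mem_ideal_pow:
  assumes "ideal J R" "x \<in> J" shows "x [^] (k::nat) \<in> ideal_pow R J k"
proof (induction k)
  case (Suc k)
  have x: "x \<in> carrier R" using assms ideal.Icarr by metis
  have "x \<otimes> x [^] k \<in> ideal_pow R J (Suc k)"
    using ideal_prod.prod[OF assms(2) Suc] by simp
  then show ?case using x by (simp add: m_comm)
qed simp

lemma (in cring) mult_ideal_prod_mem: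
  assumes "ideal I R" "ideal J R" "ideal K R" "y \<in> carrier R"
    and step: "\<And>i j. i \<in> I \<Longrightarrow> j \<in> J \<Longrightarrow> y \<otimes> (i \<otimes> j) \<in> K" and z: "z \<in> ideal_prod R I J"
  shows "y \<otimes> z \<in> K"
  using z
proof (induction z rule: ideal_prod.induct)
  case (sum s t)
  then have "s \<in> carrier R" "t \<in> carrier R"
    using ideal_prod_in_carrier[OF assms(1,2)] by auto
  then show ?case using sum assms by (simp add: r_distr ideal_add_mem)
qed (rule step)

section \<open>Uniform stabilisation of colons\<close>

text \<open>Elements of \<open>L\<close> play the role of the homogeneous submodules of the graded module with
  components \<open>M n\<close>; the index type carries the grading.\<close>

locale noetherian_families = noetherian_cring R for R (structure) +
  fixes M :: "'i \<Rightarrow> 'a set" and L :: "('i \<Rightarrow> 'a set) set"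
  assumes M_ideal: "ideal (M n) R"
    and L_ideal: "A \<in> L \<Longrightarrow> ideal (A n) R"
    and L_le: "A \<in> L \<Longrightarrow> A n \<subseteq> M n"
    and L_add: "A \<in> L \<Longrightarrow> x \<in> carrier R \<Longrightarrow> (\<lambda>n. {a \<oplus> x \<otimes> m | a m. a \<in> A n \<and> m \<in> M n}) \<in> L"
    and L_colon: "A \<in> L \<Longrightarrow> X \<subseteq> carrier R \<Longrightarrow> (\<lambda>n. {m \<in> M n. \<forall>x\<in>X. x \<otimes> m \<in> A n}) \<in> L"
    and L_acc: "(\<And>k. F k \<in> L) \<Longrightarrow> (\<And>(k::nat) n. F k n \<subseteq> F (Suc k) n) \<Longrightarrow> \<exists>k. F (Suc k) = F k"
begin

lemma M_carr: "m \<in> M n \<Longrightarrow> m \<in> carrier R"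
  using M_ideal ideal.Icarr by metis

lemma M_mult: "m \<in> M n \<Longrightarrow> x \<in> carrier R \<Longrightarrow> x \<otimes> m \<in> M n"
  using M_ideal ideal.I_l_closed by metis

lemma L_mult: "A \<in> L \<Longrightarrow> a \<in> A n \<Longrightarrow> x \<in> carrier R \<Longrightarrow> x \<otimes> a \<in> A n"
  using L_ideal ideal.I_l_closed by metis

text \<open>The chain condition, read as well-foundedness of the reversed strict order: induction on
  a family may assume the claim for all strictly larger ones.\<close>

lemma L_wf: "wf {(B, A). A \<in> L \<and> B \<in> L \<and> A < B}"
proof (rule ccontr)
  assume "\<not> ?thesis"
  then obtain F where F: "\<And>k. (F (Suc k), F k) \<in> {(B, A). A \<in> L \<and> B \<in> L \<and> A < B}"
    unfolding wf_iff_no_infinite_down_chain by blast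
  have "\<exists>k. F (Suc k) = F k"
  proof (rule L_acc)
    show "F k \<in> L" for k using F[of k] by simp
    show "F k n \<subseteq> F (Suc k) n" for k n using F[of k] by (simp add: less_le le_fun_def)
  qed
  then obtain k where "F (Suc k) = F k" by blast
  then show False using F[of k] by simp
qed

text \<open>The radical of the annihilator of the quotient of \<open>M\<close> by \<open>A\<close>:
  one exponent \<open>e\<close> has to serve all degrees at once.\<close>

definition nilp :: "('i \<Rightarrow> 'a set) \<Rightarrow> 'a set" where
  "nilp A = {x \<in> carrier R. \<exists>e::nat. \<forall>n. \<forall>m\<in>M n. x [^] e \<otimes> m \<in> A n}"

definition nonzerodiv :: "('i \<Rightarrow> 'a set) \<Rightarrow> 'a \<Rightarrow> bool" where
  "nonzerodiv A x \<longleftrightarrow> (\<forall>n. \<forall>m\<in>M n. x \<otimes> m \<in> A n \<longrightarrow> m \<in> A n)"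

lemma nonzerodiv_pow:
  assumes "nonzerodiv A x" "x \<in> carrier R" "m \<in> M n" "x [^] (e::nat) \<otimes> m \<in> A n"
  shows "m \<in> A n"
  using assms(4)
proof (induction e)
  case 0
  then show ?case using M_carr[OF assms(3)] by simp
next
  case (Suc e)
  have "x \<otimes> (x [^] e \<otimes> m) = x [^] Suc e \<otimes> m"
    using assms(2) M_carr[OF assms(3)] by (simp add: m_ac)
  then have "x [^] e \<otimes> m \<in> A n"
    using assms(1,2) Suc.prems M_mult[OF assms(3), of "x [^] e"] unfolding nonzerodiv_def by auto
  then show ?case by (rule Suc.IH)
qed

text \<open>Fitting's argument. Once the colons of \<open>A\<close> by \<open>x^e\<close> and
  \<open>x^(2e)\<close> agree, \<open>A\<close> is the intersection of \<open>A + x^e M\<close> with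
  the colon by \<open>x^e\<close>, so irreducibility forces one of them to be \<open>A\<close>. The
  first case makes \<open>x\<close> nilpotent, the second a nonzerodivisor.\<close>

lemma irreducible_nilp_or_nonzerodiv:
  assumes A: "A \<in> L" and x: "x \<in> carrier R"
    and irr: "\<And>B C. B \<in> L \<Longrightarrow> C \<in> L \<Longrightarrow> A < B \<Longrightarrow> A < C \<Longrightarrow> \<exists>n. A n \<noteq> B n \<inter> C n"
  shows "x \<in> nilp A \<or> nonzerodiv A x"
proof -
  define C where "C e = (\<lambda>n. {m \<in> M n. \<forall>y\<in>{x [^] (e::nat)}. y \<otimes> m \<in> A n})" for e
  have CL: "C e \<in> L" for e unfolding C_def by (rule L_colon[OF A]) (use x in auto)
  have Cle: "C e n \<subseteq> C f n" if "e \<le> f" for e f n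
  proof
    fix m assume m: "m \<in> C e n"
    have "x [^] f \<otimes> m = x [^] (f - e) \<otimes> (x [^] e \<otimes> m)"
      using m x that M_carr[of m n] by (simp add: C_def m_assoc[symmetric] nat_pow_mult)
    then show "m \<in> C f n" using m x L_mult[OF A] by (simp add: C_def)
  qed
  \<comment> \<open>Exponents run through powers of two, so that one stationary step gives
    \<open>C (2e) = C e\<close> directly.\<close>
  have "\<exists>k. C (2 ^ Suc k) = C (2 ^ k)"
    by (rule L_acc[of "\<lambda>k. C (2 ^ k)", OF CL Cle]) simp
  then obtain k where k: "C (2 ^ Suc k) = C (2 ^ k)" by blast
  define e where "e = (2::nat) ^ k"
  have e: "C (e + e) = C e" "e \<ge> 1" using k by (simp_all add: e_def mult_2)
  define B where "B = (\<lambda>n. {a \<oplus> x [^] e \<otimes> m | a m. a \<in> A n \<and> m \<in> M n})"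
  have BL: "B \<in> L" unfolding B_def by (rule L_add[OF A]) (use x in auto)
  have AB: "A \<le> B"
  proof (rule le_funI, rule subsetI)
    fix n a assume a: "a \<in> A n"
    then have "a = a \<oplus> x [^] e \<otimes> \<zero>" using x L_le[OF A] M_carr by fastforce
    then show "a \<in> B n" using a ideal_zero_mem[OF M_ideal] unfolding B_def by blast
  qed
  have AC: "A \<le> C e"
    using L_le[OF A] L_mult[OF A] x by (auto simp: C_def le_fun_def)
  have "A n = B n \<inter> C e n" for n
  proof
    show "A n \<subseteq> B n \<inter> C e n" using AB AC by (auto simp: le_fun_def)
    show "B n \<inter> C e n \<subseteq> A n"
    proof
      fix z assume z: "z \<in> B n \<inter> C e n"
      then obtain a m where am: "a \<in> A n" "m \<in> M n" "z = a \<oplus> x [^] e \<otimes> m" by (auto simp: B_def)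
      have c: "a \<in> carrier R" "m \<in> carrier R" using am L_le[OF A] M_carr by auto
      \<comment> \<open>As \<open>x^e\<close> multiplies both \<open>z\<close> and \<open>a\<close>
        into \<open>A\<close>, it follows that \<open>x^(2e) m\<close> lies in \<open>A\<close>;
        then \<open>C (e + e) = C e\<close> lowers the exponent to \<open>e\<close>.\<close>
      have "x [^] e \<otimes> z \<in> A n" using z by (auto simp: C_def)
      moreover have "x [^] e \<otimes> z = x [^] e \<otimes> a \<oplus> x [^] (e + e) \<otimes> m"
        using am c x by (simp add: r_distr nat_pow_mult[symmetric] m_assoc)
      ultimately have "(x [^] e \<otimes> a \<oplus> x [^] (e + e) \<otimes> m) \<ominus> x [^] e \<otimes> a \<in> A n"
        using ideal_minus_mem[OF L_ideal[OF A]] L_mult[OF A am(1), of "x [^] e"] x by auto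
      then have "x [^] (e + e) \<otimes> m \<in> A n"
        using c x by (simp add: a_minus_def a_comm[of "x [^] e \<otimes> a"] a_assoc r_neg)
      then have "m \<in> C (e + e) n" using am by (simp add: C_def)
      then have "x [^] e \<otimes> m \<in> A n" unfolding e(1) by (simp add: C_def)
      then show "z \<in> A n" using am ideal_add_mem[OF L_ideal[OF A]] by auto
    qed
  qed
  with irr[OF BL CL] AB AC have "A = B \<or> A = C e" by (metis order_neq_le_trans)
  then show ?thesis
  proof
    assume "A = B"
    have "x [^] e \<otimes> m \<in> A n" if "m \<in> M n" for n m
    proof -
      have "x [^] e \<otimes> m = \<zero> \<oplus> x [^] e \<otimes> m" using x M_carr[OF that] by simp
      then have "x [^] e \<otimes> m \<in> B n"
        using that ideal_zero_mem[OF L_ideal[OF A]] unfolding B_def by blast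
      then show ?thesis using \<open>A = B\<close> by simp
    qed
    then show ?thesis using x by (auto simp: nilp_def)
  next
    assume AC: "A = C e"
    have "m \<in> A n" if "m \<in> M n" "x \<otimes> m \<in> A n" for n m
    proof -
      \<comment> \<open>The bound \<open>e \<ge> 1\<close> enters here: it places \<open>C 1\<close>
        inside \<open>C e\<close>.\<close>
      have "m \<in> C 1 n" using that x by (simp add: C_def)
      then show ?thesis using Cle[OF e(2)] AC by auto
    qed
    then show ?thesis by (auto simp: nonzerodiv_def)
  qed
qed

text \<open>For each \<open>x\<close> in \<open>S\<close> in turn, multiply by the last power of
  \<open>x\<close> that keeps the element outside \<open>B\<close>. By commutativity the elements
  treated earlier still multiply it into \<open>B\<close>. Nilpotency is measured modulo
  \<open>A\<close>, while the conclusion concerns any larger \<open>B\<close>.\<close>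

lemma socle_element:
  assumes "finite S" "S \<subseteq> nilp A" "A \<in> L" "B \<in> L" "\<And>n. A n \<subseteq> B n" "m \<in> M n" "m \<notin> B n"
  shows "\<exists>m'\<in>M n. m' \<notin> B n \<and> (\<forall>x\<in>S. x \<otimes> m' \<in> B n)"
  using assms(1,2)
proof (induction S rule: finite_induct)
  case empty
  then show ?case using assms by auto
next
  case (insert x S)
  then obtain m' where m': "m' \<in> M n" "m' \<notin> B n" "\<forall>x\<in>S. x \<otimes> m' \<in> B n" by auto
  have x: "x \<in> carrier R" using insert by (auto simp: nilp_def)
  define P where "P e \<longleftrightarrow> x [^] (e::nat) \<otimes> m' \<in> B n" for e
  have "x \<in> nilp A" using insert.prems by simp
  then obtain e::nat where "x [^] e \<otimes> m' \<in> A n" using m'(1) unfolding nilp_def by blast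
  then have "\<exists>e. P e" using assms(5) unfolding P_def by blast
  moreover have "\<not> P 0" using m' M_carr by (simp add: P_def)
  ultimately obtain e where e: "\<not> P e" "P (Suc e)"
    using nat_induct[of "\<lambda>e. \<not> P e"] by blast
  let ?m = "x [^] e \<otimes> m'"
  have "x \<otimes> ?m \<in> B n" using e(2) x M_carr[OF m'(1)] by (simp add: P_def m_ac)
  moreover have "y \<otimes> ?m \<in> B n" if "y \<in> S" for y
  proof -
    have y: "y \<in> carrier R" using insert that by (auto simp: nilp_def)
    have "y \<otimes> ?m = x [^] e \<otimes> (y \<otimes> m')" using x y M_carr[OF m'(1)] by (simp add: m_ac)
    then show ?thesis using m'(3) that L_mult[OF assms(4)] x by simp
  qed
  moreover have "?m \<in> M n" "?m \<notin> B n" using M_mult[OF m'(1)] x e(1) by (auto simp: P_def)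
  ultimately show ?case by blast
qed

text \<open>Closure under sums uses the dichotomy in place of a binomial expansion: were
  \<open>a \<oplus> b\<close> a nonzerodivisor modulo \<open>A\<close>, an element outside
  \<open>A\<close> killed by both \<open>a\<close> and \<open>b\<close> would contradict it.\<close>

lemma irreducible_nilp_ideal:
  assumes A: "A \<in> L" and dich: "\<And>x. x \<in> carrier R \<Longrightarrow> x \<in> nilp A \<or> nonzerodiv A x"
  shows "ideal (nilp A) R"
proof (rule ideal_by_closure)
  show "nilp A \<subseteq> carrier R" by (auto simp: nilp_def)
  have "\<zero> [^] (1::nat) \<otimes> m \<in> A n" if "m \<in> M n" for m n
    using M_carr[OF that] ideal_zero_mem[OF L_ideal[OF A]] by simp
  then show "\<zero> \<in> nilp A" unfolding nilp_def by blast
next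
  fix a b assume ab: "a \<in> nilp A" "b \<in> nilp A"
  then have c: "a \<in> carrier R" "b \<in> carrier R" by (auto simp: nilp_def)
  show "a \<oplus> b \<in> nilp A"
  proof (rule ccontr)
    assume n: "a \<oplus> b \<notin> nilp A"
    then have nz: "nonzerodiv A (a \<oplus> b)" using dich[of "a \<oplus> b"] c by auto
    \<comment> \<open>Failure of nilpotency at exponent 0 just says that \<open>A\<close> is not all
      of \<open>M\<close>.\<close>
    from n c obtain n m where m: "m \<in> M n" "(a \<oplus> b) [^] (0::nat) \<otimes> m \<notin> A n"
      unfolding nilp_def by blast
    then have "m \<notin> A n" using M_carr by auto
    from socle_element[of "{a, b}", OF _ _ A A _ m(1) this] ab
    obtain m' where m': "m' \<in> M n" "m' \<notin> A n" "a \<otimes> m' \<in> A n" "b \<otimes> m' \<in> A n" by auto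
    have "(a \<oplus> b) \<otimes> m' \<in> A n"
      using m' c M_carr[OF m'(1)] ideal_add_mem[OF L_ideal[OF A]] by (simp add: l_distr)
    then show False using nz m' unfolding nonzerodiv_def by blast
  qed
next
  fix a x assume a: "a \<in> nilp A" and x: "x \<in> carrier R"
  then obtain e::nat where c: "a \<in> carrier R" and e: "\<And>n m. m \<in> M n \<Longrightarrow> a [^] e \<otimes> m \<in> A n"
    by (auto simp: nilp_def)
  have "(x \<otimes> a) [^] e \<otimes> m \<in> A n" if m: "m \<in> M n" for n m
  proof -
    have "(x \<otimes> a) [^] e \<otimes> m = x [^] e \<otimes> (a [^] e \<otimes> m)"
      using x c M_carr[OF m] by (simp add: nat_pow_distrib m_assoc)
    then show ?thesis using L_mult[OF A e[OF m]] x by simp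
  qed
  then show "x \<otimes> a \<in> nilp A" using x c by (auto simp: nilp_def)
qed

text \<open>The colon of \<open>A\<close> by the \<open>k\<close>-th power of \<open>nilp A\<close>
  inside \<open>M\<close>. Iterating single colons lets \<open>L_colon\<close> apply at each stage,
  before \<open>nilp A\<close> is known to be an ideal.\<close>

primrec nilp_colon :: "('i \<Rightarrow> 'a set) \<Rightarrow> nat \<Rightarrow> 'i \<Rightarrow> 'a set" where
  "nilp_colon A 0 = A"
| "nilp_colon A (Suc k) = (\<lambda>n. {m \<in> M n. \<forall>x\<in>nilp A. x \<otimes> m \<in> nilp_colon A k n})"

lemma nilp_subset: "nilp A \<subseteq> carrier R"
  by (auto simp: nilp_def)

lemma nilp_colon_L: "A \<in> L \<Longrightarrow> nilp_colon A k \<in> L"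
  by (induction k) (auto intro: L_colon[OF _ nilp_subset])

lemma nilp_colon_mono:
  assumes "A \<in> L" shows "nilp_colon A k n \<subseteq> nilp_colon A (Suc k) n"
  using L_le[OF nilp_colon_L[OF assms], of k n] L_mult[OF nilp_colon_L[OF assms], of _ k n]
    nilp_subset[of A] by auto

text \<open>Let \<open>B\<close> be a stationary term of the chain of colons. If \<open>B\<close>
  were not all of \<open>M\<close>, \<open>socle_element\<close> applied to finitely many generators
  of \<open>nilp A\<close> would give an element of the next colon outside \<open>B\<close>.\<close>

lemma irreducible_nilp_colon_top:
  assumes A: "A \<in> L" and dich: "\<And>x. x \<in> carrier R \<Longrightarrow> x \<in> nilp A \<or> nonzerodiv A x"
  shows "\<exists>k. \<forall>n. M n \<subseteq> nilp_colon A k n"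
proof -
  obtain k where k: "nilp_colon A (Suc k) = nilp_colon A k"
    using L_acc[of "nilp_colon A", OF nilp_colon_L[OF A] nilp_colon_mono[OF A]] by blast
  define B where "B = nilp_colon A k"
  have BL: "B \<in> L" and AB: "A n \<subseteq> B n" for n
    unfolding B_def using nilp_colon_L[OF A] lift_Suc_mono_le[of "\<lambda>k. nilp_colon A k n" 0 k]
      nilp_colon_mono[OF A] by auto
  obtain S where S: "S \<subseteq> carrier R" "finite S" "nilp A = Idl S"
    using finetely_gen[OF irreducible_nilp_ideal[OF A dich]] by auto
  have "m \<in> B n" if m: "m \<in> M n" for m n
  proof (rule ccontr)
    assume "m \<notin> B n"
    from socle_element[OF S(2) _ A BL AB m this] genideal_self[OF S(1)] S(3)
    obtain m' where m': "m' \<in> M n" "m' \<notin> B n" "\<And>x. x \<in> S \<Longrightarrow> x \<otimes> m' \<in> B n" by auto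
    have mc: "m' \<in> carrier R" using M_carr[OF m'(1)] .
    have "x \<otimes> m' \<in> B n" if x: "x \<in> nilp A" for x
    proof -
      have "m' \<otimes> x \<in> B n"
        by (rule genideal_mult_mem[OF S(1) L_ideal[OF BL] mc])
          (use m' mc S x in \<open>auto simp: m_comm[of m'] subsetD[OF S(1)]\<close>)
      then show ?thesis using mc x nilp_subset[of A] m_comm[of m' x] by auto
    qed
    then have "m' \<in> nilp_colon A (Suc k) n" using m' by (simp add: B_def)
    then show False using m'(2) unfolding k B_def by blast
  qed
  then show ?thesis unfolding B_def by blast
qed

text \<open>Each stage of the iterated colon absorbs one factor from \<open>J\<close>.\<close>

lemma nilp_colon_mult:
  assumes A: "A \<in> L" and J: "ideal J R" "J \<subseteq> nilp A"
  shows "m \<in> nilp_colon A k n \<Longrightarrow> m \<in> M n \<Longrightarrow> z \<in> ideal_pow R J k \<Longrightarrow> m \<otimes> z \<in> A n"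
proof (induction k arbitrary: m z)
  case 0
  then show ?case using L_mult[OF A, of m n z] M_carr m_comm[of m z] by auto
next
  case (Suc k)
  have mc: "m \<in> carrier R" using M_carr[OF Suc.prems(2)] .
  have "m \<otimes> (i \<otimes> j) \<in> A n" if ij: "i \<in> J" "j \<in> ideal_pow R J k" for i j
  proof -
    have c: "i \<in> carrier R" "j \<in> carrier R"
      using ij ideal.Icarr[OF J(1)] ideal.Icarr[OF ideal_pow_ideal[OF J(1)]] by auto
    have "(i \<otimes> m) \<otimes> j \<in> A n"
      by (rule Suc.IH) (use Suc.prems ij J M_mult c in auto)
    then show ?thesis using c mc by (simp add: m_ac)
  qed
  then show ?case
    by (rule mult_ideal_prod_mem[OF J(1) ideal_pow_ideal[OF J(1)] L_ideal[OF A] mc])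
      (use Suc.prems in auto)
qed

text \<open>If \<open>A\<close> is an intersection of two larger families, the maximum of their
  constants works. Otherwise either \<open>J\<close> lies in \<open>nilp A\<close>, and the exponent
  \<open>k\<close> with \<open>nilp_colon A k\<close> equal to \<open>M\<close> works for every
  \<open>y\<close>, or \<open>J\<close> contains a nonzerodivisor \<open>x\<close> modulo
  \<open>A\<close>, and \<open>x^e y\<close> in \<open>A\<close> already forces \<open>y\<close>
  into \<open>A\<close>.\<close>

theorem uniform_colon:
  assumes "A \<in> L"
  shows "\<exists>c. \<forall>J e n. \<forall>y\<in>M n. ideal J R \<longrightarrow> (\<forall>z\<in>ideal_pow R J e. y \<otimes> z \<in> A n)
           \<longrightarrow> (\<forall>z\<in>ideal_pow R J c. y \<otimes> z \<in> A n)"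
  using assms
proof (induction A rule: wf_induct_rule[OF L_wf])
  case (1 A)
  note A = \<open>A \<in> L\<close>
  show ?case
  proof (cases "\<exists>B C. B \<in> L \<and> C \<in> L \<and> A < B \<and> A < C \<and> (\<forall>n. A n = B n \<inter> C n)")
    case True
    then obtain B C where BC: "B \<in> L" "C \<in> L" "A < B" "A < C" and eq: "\<And>n. A n = B n \<inter> C n" by auto
    obtain b where b: "\<And>J e n y. y \<in> M n \<Longrightarrow> ideal J R \<Longrightarrow> (\<forall>z\<in>ideal_pow R J e. y \<otimes> z \<in> B n)
           \<Longrightarrow> (\<forall>z\<in>ideal_pow R J b. y \<otimes> z \<in> B n)"
      using 1(1)[of B] A BC by auto blast
    obtain c where c: "\<And>J e n y. y \<in> M n \<Longrightarrow> ideal J R \<Longrightarrow> (\<forall>z\<in>ideal_pow R J e. y \<otimes> z \<in> C n)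
           \<Longrightarrow> (\<forall>z\<in>ideal_pow R J c. y \<otimes> z \<in> C n)"
      using 1(1)[of C] A BC by auto blast
    show ?thesis
    proof (intro exI[of _ "max b c"] allI ballI impI)
      fix J e n y z
      assume *: "y \<in> M n" "ideal J R" "\<forall>z\<in>ideal_pow R J e. y \<otimes> z \<in> A n" "z \<in> ideal_pow R J (max b c)"
      have "z \<in> ideal_pow R J b" "z \<in> ideal_pow R J c"
        using *(4) ideal_pow_antimono[OF *(2)] max.cobounded1 max.cobounded2 by blast+
      then show "y \<otimes> z \<in> A n" using b[OF *(1,2), of e] c[OF *(1,2), of e] *(3) unfolding eq by auto
    qed
  next
    case False
    then have dich: "x \<in> nilp A \<or> nonzerodiv A x" if "x \<in> carrier R" for x
      using irreducible_nilp_or_nonzerodiv[OF A that] by blast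
    obtain k where k: "\<And>n. M n \<subseteq> nilp_colon A k n"
      using irreducible_nilp_colon_top[OF A dich] by blast
    show ?thesis
    proof (intro exI[of _ k] allI ballI impI)
      fix J e n y z
      assume *: "y \<in> M n" "ideal J R" "\<forall>z\<in>ideal_pow R J e. y \<otimes> z \<in> A n" "z \<in> ideal_pow R J k"
      show "y \<otimes> z \<in> A n"
      proof (cases "J \<subseteq> nilp A")
        case True
        then show ?thesis using nilp_colon_mult[OF A *(2)] k * by blast
      next
        case False
        then obtain x where x: "x \<in> J" "x \<notin> nilp A" by auto
        have xc: "x \<in> carrier R" using ideal.Icarr[OF *(2) x(1)] .
        have "x [^] e \<otimes> y \<in> A n"
          using *(3) nat_pow_mem_ideal_pow[OF *(2) x(1), of e] xc M_carr[OF *(1)]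
          by (simp add: m_comm)
        then have "y \<in> A n" using nonzerodiv_pow dich[OF xc] x(2) xc *(1) by blast
        moreover have "z \<in> carrier R" using ideal.Icarr[OF ideal_pow_ideal[OF *(2)] *(4)] .
        ultimately show ?thesis using L_mult[OF A, of y n z] M_carr[OF *(1)] by (simp add: m_comm)
      qed
    qed
  qed
qed

end

section \<open>The ascending chain condition for multigraded families\<close>

lemma nat_seq_mono_subseq:
  fixes s :: "nat \<Rightarrow> nat"
  shows "\<exists>f::nat \<Rightarrow> nat. strict_mono f \<and> mono (s \<circ> f)"
proof -
  obtain f :: "nat \<Rightarrow> nat" where f: "strict_mono f" "monoseq (\<lambda>k. s (f k))" using seq_monosub[of s] by blast
  show ?thesis
  proof (cases "mono (s \<circ> f)")
    case False
    then have dec: "s (f k) \<le> s (f j)" if "j \<le> k" for j k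
      using f(2) that by (auto simp: monoseq_def mono_def)
    \<comment> \<open>A decreasing sequence of naturals is constant from a place where its least
      value is attained; the tail from there is the required subsequence.\<close>
    obtain k where k: "\<And>j. s (f k) \<le> s (f j)"
      using ex_has_least_nat[of "\<lambda>_. True" 0 "\<lambda>j. s (f j)"] by auto
    have "s (f (k + j)) = s (f k)" for j using dec[of k "k + j"] k[of "k + j"] by simp
    then have "mono (s \<circ> (\<lambda>j. f (k + j)))" by (simp add: mono_def)
    moreover have "strict_mono (\<lambda>j. f (k + j))" using f(1) by (simp add: strict_mono_def)
    ultimately show ?thesis by (intro exI[of _ "\<lambda>j. f (k + j)"] conjI)
  qed (use f(1) in blast)
qed

text \<open>Dickson's lemma in sequence form: coordinates are treated one by one, and passing to a
  further subsequence preserves monotonicity in the earlier ones.\<close>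

lemma dickson_subseq:
  fixes \<alpha> :: "nat \<Rightarrow> nat \<Rightarrow> nat"
  shows "\<exists>f::nat \<Rightarrow> nat. strict_mono f \<and> (\<forall>j<N. mono (\<lambda>k. \<alpha> (f k) j))"
proof (induction N)
  case 0
  show ?case by (rule exI[of _ id]) (simp add: strict_mono_def)
next
  case (Suc N)
  then obtain f :: "nat \<Rightarrow> nat" where f: "strict_mono f" "\<And>j. j < N \<Longrightarrow> mono (\<lambda>k. \<alpha> (f k) j)" by blast
  obtain h :: "nat \<Rightarrow> nat" where h: "strict_mono h" "mono ((\<lambda>k. \<alpha> (f k) N) \<circ> h)"
    using nat_seq_mono_subseq by blast
  have "mono (\<lambda>k. \<alpha> ((f \<circ> h) k) j)" if "j < Suc N" for j
  proof (cases "j = N")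
    case True
    then show ?thesis using h(2) by (simp add: comp_def)
  next
    case False
    then show ?thesis using f(2)[of j] that strict_mono_mono[OF h(1)] by (simp add: mono_def)
  qed
  then show ?case using strict_mono_o[OF f(1) h(1)] by blast
qed

text \<open>This makes the lexicographic order on exponent lists a monomial order. Equal lengths
  keep \<open>map2\<close> from truncating.\<close>

lemma list_less_add_right:
  fixes xs ys zs :: "nat list"
  assumes "length xs = length ys" "length ys = length zs" "xs < ys"
  shows "map2 (+) xs zs < map2 (+) ys zs"
  using assms by (induction xs ys zs rule: list_induct3) auto

section \<open>Monomials, Rees components and leading coefficients\<close>

text \<open>The generator \<open>g j\<close> has degree \<open>d j\<close>, i.e. it lies in the ideal with index \<open>d j\<close>.\<close>

locale graded_generators = noetherian_cring R for R (structure) +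
  fixes N :: nat and g :: "nat \<Rightarrow> 'a" and d :: "nat \<Rightarrow> nat"
  assumes g_closed: "j < N \<Longrightarrow> g j \<in> carrier R"
begin

text \<open>Vanishing from \<open>N\<close> on makes \<open>key\<close> injective on exponent
  functions and leaves finitely many of each degree.\<close>

definition exps :: "(nat \<Rightarrow> nat) set" where
  "exps = {\<alpha>. \<forall>j\<ge>N. \<alpha> j = 0}"

definition deg :: "(nat \<Rightarrow> nat) \<Rightarrow> nat \<Rightarrow> nat" where
  "deg \<alpha> = (\<lambda>i. \<Sum>j<N. if d j = i then \<alpha> j else 0)"

definition mon :: "(nat \<Rightarrow> nat) \<Rightarrow> 'a" where
  "mon \<alpha> = (\<Otimes>j\<in>{..<N}. g j [^] \<alpha> j)"

definition key :: "(nat \<Rightarrow> nat) \<Rightarrow> nat list" where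
  "key \<alpha> = map \<alpha> [0..<N]"

text \<open>The component of degree \<open>n\<close> of the multigraded Rees algebra;
  \<open>ideal_prod_pows_eq_rees\<close> identifies it with a product of ideal powers.\<close>

definition rees :: "(nat \<Rightarrow> nat) \<Rightarrow> 'a set" where
  "rees n = Idl (mon ` {\<alpha> \<in> exps. deg \<alpha> = n})"

definition lower :: "(nat \<Rightarrow> nat) \<Rightarrow> 'a set" where
  "lower \<alpha> = Idl (mon ` {\<beta> \<in> exps. deg \<beta> = deg \<alpha> \<and> key \<beta> < key \<alpha>})"

definition submods :: "((nat \<Rightarrow> nat) \<Rightarrow> 'a set) set" where
  "submods = {A. (\<forall>n. ideal (A n) R \<and> A n \<subseteq> rees n) \<and>
     (\<forall>n. \<forall>\<alpha>\<in>exps. \<forall>x\<in>A n. mon \<alpha> \<otimes> x \<in> A (\<lambda>i. n i + deg \<alpha> i))}"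

text \<open>Leading coefficients are read off representations and not off elements: an element of
  \<open>A (deg \<alpha>)\<close> may be written in several ways as a leading term plus a lower
  tail, and each way contributes.\<close>

definition lead :: "((nat \<Rightarrow> nat) \<Rightarrow> 'a set) \<Rightarrow> (nat \<Rightarrow> nat) \<Rightarrow> 'a set" where
  "lead A \<alpha> = {c \<in> carrier R. \<exists>w\<in>lower \<alpha>. c \<otimes> mon \<alpha> \<oplus> w \<in> A (deg \<alpha>)}"

lemma mon_closed: "mon \<alpha> \<in> carrier R"
  unfolding mon_def by (rule finprod_closed) (auto simp: g_closed)

lemma mon_image_closed: "mon ` X \<subseteq> carrier R"
  using mon_closed by auto

lemma mon_mem_genideal: "\<alpha> \<in> X \<Longrightarrow> mon \<alpha> \<in> Idl (mon ` X)"
  using genideal_self[OF mon_image_closed] by blast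

lemma mon_add: "mon (\<lambda>j. \<alpha> j + \<beta> j) = mon \<alpha> \<otimes> mon \<beta>"
proof -
  have "mon (\<lambda>j. \<alpha> j + \<beta> j) = (\<Otimes>j\<in>{..<N}. g j [^] \<alpha> j \<otimes> g j [^] \<beta> j)"
    unfolding mon_def by (rule finprod_cong') (auto simp: g_closed nat_pow_mult)
  also have "\<dots> = mon \<alpha> \<otimes> mon \<beta>"
    unfolding mon_def by (rule finprod_multf) (auto simp: g_closed)
  finally show ?thesis .
qed

lemma mon_zero: "mon (\<lambda>_. 0) = \<one>"
  by (simp add: mon_def)

lemma mon_unit:
  assumes "j < N" shows "mon (\<lambda>k. if k = j then 1 else 0) = g j"
proof -
  have "mon (\<lambda>k. if k = j then 1 else 0) = (\<Otimes>k\<in>{..<N}. if j = k then g k else \<one>)"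
    unfolding mon_def by (rule finprod_cong') (auto simp: g_closed)
  also have "\<dots> = g j"
    by (rule finprod_singleton) (use assms in \<open>auto simp: g_closed\<close>)
  finally show ?thesis .
qed

lemma deg_add: "deg (\<lambda>j. \<alpha> j + \<beta> j) = (\<lambda>i. deg \<alpha> i + deg \<beta> i)"
  unfolding deg_def by (auto simp: sum.distrib[symmetric] intro!: sum.cong)

lemma deg_unit: "j < N \<Longrightarrow> deg (\<lambda>k. if k = j then 1 else 0) = (\<lambda>i. if i = d j then 1 else 0)"
proof
  fix i assume "j < N"
  have "deg (\<lambda>k. if k = j then 1 else 0) i = (\<Sum>k<N. if k = j then (if d j = i then 1 else 0) else 0)"
    unfolding deg_def by (rule sum.cong) auto
  also have "\<dots> = (if i = d j then 1 else 0)" using \<open>j < N\<close> by auto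
  finally show "deg (\<lambda>k. if k = j then 1 else 0) i = (if i = d j then 1 else 0)" .
qed

lemma exps_add: "\<alpha> \<in> exps \<Longrightarrow> \<beta> \<in> exps \<Longrightarrow> (\<lambda>j. \<alpha> j + \<beta> j) \<in> exps"
  by (simp add: exps_def)

lemma exps_unit: "j < N \<Longrightarrow> (\<lambda>k. if k = j then 1 else 0) \<in> exps"
  by (auto simp: exps_def)

lemma key_add_less:
  assumes "key \<alpha> < key \<beta>"
  shows "key (\<lambda>j. \<alpha> j + \<gamma> j) < key (\<lambda>j. \<beta> j + \<gamma> j)"
proof -
  have "map2 (+) (key \<alpha>) (key \<gamma>) = key (\<lambda>j. \<alpha> j + \<gamma> j)" for \<alpha> \<gamma>
    by (rule nth_equalityI) (auto simp: key_def)
  with list_less_add_right[of "key \<alpha>" "key \<beta>" "key \<gamma>"] assms show ?thesis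
    by (simp add: key_def)
qed

lemma key_inj: "inj_on key exps"
proof (rule inj_onI)
  fix \<alpha> \<beta> assume *: "\<alpha> \<in> exps" "\<beta> \<in> exps" "key \<alpha> = key \<beta>"
  show "\<alpha> = \<beta>"
  proof
    fix j
    show "\<alpha> j = \<beta> j" using * by (cases "j < N") (auto simp: key_def exps_def)
  qed
qed

text \<open>Each exponent \<alpha> \<open>j\<close> is at most the degree in component
  \<open>d j\<close>, which bounds all exponents by \<open>?B\<close>.\<close>

lemma finite_exps_deg: "finite {\<alpha> \<in> exps. deg \<alpha> = n}"
proof (rule finite_subset)
  let ?B = "\<Sum>j<N. n (d j)"
  show "finite {\<alpha>. \<forall>j. (j \<in> {..<N} \<longrightarrow> \<alpha> j \<in> {..?B}) \<and> (j \<notin> {..<N} \<longrightarrow> \<alpha> j = 0)}"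
    by (rule finite_set_of_finite_funs) auto
  have "\<alpha> j \<le> (\<Sum>j<N. deg \<alpha> (d j))" if "j < N" for \<alpha> j
  proof -
    have "\<alpha> j \<le> deg \<alpha> (d j)"
      unfolding deg_def using member_le_sum[of j "{..<N}" "\<lambda>k. if d k = d j then \<alpha> k else 0"] that by auto
    also have "\<dots> \<le> (\<Sum>j<N. deg \<alpha> (d j))"
      using member_le_sum[of j "{..<N}" "\<lambda>j. deg \<alpha> (d j)"] that by auto
    finally show ?thesis .
  qed
  then show "{\<alpha> \<in> exps. deg \<alpha> = n}
      \<subseteq> {\<alpha>. \<forall>j. (j \<in> {..<N} \<longrightarrow> \<alpha> j \<in> {..?B}) \<and> (j \<notin> {..<N} \<longrightarrow> \<alpha> j = 0)}"
    by (auto simp: exps_def)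
qed

lemma rees_ideal: "ideal (rees n) R"
  unfolding rees_def by (rule genideal_ideal[OF mon_image_closed])

lemma lower_ideal: "ideal (lower \<alpha>) R"
  unfolding lower_def by (rule genideal_ideal[OF mon_image_closed])

lemma mon_mem_rees: "\<alpha> \<in> exps \<Longrightarrow> mon \<alpha> \<in> rees (deg \<alpha>)"
  unfolding rees_def by (rule mon_mem_genideal) simp

lemma mon_mult_rees:
  assumes "\<alpha> \<in> exps" "x \<in> rees n"
  shows "mon \<alpha> \<otimes> x \<in> rees (\<lambda>i. n i + deg \<alpha> i)"
proof (rule genideal_mult_mem[OF mon_image_closed rees_ideal mon_closed _ assms(2)[unfolded rees_def]])
  fix s assume "s \<in> mon ` {\<alpha> \<in> exps. deg \<alpha> = n}"
  then obtain \<beta> where \<beta>: "\<beta> \<in> exps" "deg \<beta> = n" "s = mon \<beta>" by auto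
  then show "mon \<alpha> \<otimes> s \<in> rees (\<lambda>i. n i + deg \<alpha> i)"
    using mon_mem_rees[OF exps_add[OF \<beta>(1) assms(1)]]
    by (simp add: deg_add mon_add m_comm mon_closed)
qed

lemma submodsD:
  assumes "A \<in> submods"
  shows "ideal (A n) R" "A n \<subseteq> rees n"
    "\<alpha> \<in> exps \<Longrightarrow> x \<in> A n \<Longrightarrow> mon \<alpha> \<otimes> x \<in> A (\<lambda>i. n i + deg \<alpha> i)"
  using assms by (auto simp: submods_def)

lemma submodsI:
  assumes "\<And>n. ideal (A n) R" "\<And>n. A n \<subseteq> rees n"
    "\<And>\<alpha> x n. \<alpha> \<in> exps \<Longrightarrow> x \<in> A n \<Longrightarrow> mon \<alpha> \<otimes> x \<in> A (\<lambda>i. n i + deg \<alpha> i)"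
  shows "A \<in> submods"
  using assms by (simp add: submods_def)

section \<open>Ideals of leading coefficients and the chain condition\<close>

lemma lead_ideal:
  assumes A: "A \<in> submods" shows "ideal (lead A \<alpha>) R"
proof (rule ideal_by_closure)
  note wc = ideal.Icarr[OF lower_ideal]
  show "lead A \<alpha> \<subseteq> carrier R" by (auto simp: lead_def)
  show "\<zero> \<in> lead A \<alpha>"
    using ideal_zero_mem[OF lower_ideal] ideal_zero_mem[OF submodsD(1)[OF A]] mon_closed
    by (auto simp: lead_def intro!: bexI[of _ \<zero>])
  fix a assume "a \<in> lead A \<alpha>"
  then obtain w where a: "a \<in> carrier R" "w \<in> lower \<alpha>" "a \<otimes> mon \<alpha> \<oplus> w \<in> A (deg \<alpha>)"
    by (auto simp: lead_def)
  {
    fix b assume "b \<in> lead A \<alpha>"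
    then obtain v where b: "b \<in> carrier R" "v \<in> lower \<alpha>" "b \<otimes> mon \<alpha> \<oplus> v \<in> A (deg \<alpha>)"
      by (auto simp: lead_def)
    have "(a \<oplus> b) \<otimes> mon \<alpha> \<oplus> (w \<oplus> v) = (a \<otimes> mon \<alpha> \<oplus> w) \<oplus> (b \<otimes> mon \<alpha> \<oplus> v)"
      using a b wc mon_closed by (simp add: l_distr a_ac)
    then have "(a \<oplus> b) \<otimes> mon \<alpha> \<oplus> (w \<oplus> v) \<in> A (deg \<alpha>)"
      using a b ideal_add_mem[OF submodsD(1)[OF A]] by simp
    then show "a \<oplus> b \<in> lead A \<alpha>"
      using a b ideal_add_mem[OF lower_ideal] by (auto simp: lead_def)
  next
    fix x assume x: "x \<in> carrier R"
    have "(x \<otimes> a) \<otimes> mon \<alpha> \<oplus> (x \<otimes> w) = x \<otimes> (a \<otimes> mon \<alpha> \<oplus> w)"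
      using a x wc mon_closed by (simp add: r_distr m_assoc)
    then have "(x \<otimes> a) \<otimes> mon \<alpha> \<oplus> (x \<otimes> w) \<in> A (deg \<alpha>)"
      using a x ideal.I_l_closed[OF submodsD(1)[OF A]] by simp
    then show "x \<otimes> a \<in> lead A \<alpha>"
      using a x ideal.I_l_closed[OF lower_ideal] by (auto simp: lead_def)
  }
qed

lemma lead_mono_family: "(\<And>n. A n \<subseteq> B n) \<Longrightarrow> lead A \<alpha> \<subseteq> lead B \<alpha>"
  by (auto simp: lead_def)

lemma mon_mult_lower:
  assumes "\<delta> \<in> exps" "w \<in> lower \<alpha>"
  shows "mon \<delta> \<otimes> w \<in> lower (\<lambda>j. \<alpha> j + \<delta> j)"
proof (rule genideal_mult_mem[OF mon_image_closed lower_ideal mon_closed _ assms(2)[unfolded lower_def]])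
  fix s assume "s \<in> mon ` {\<beta> \<in> exps. deg \<beta> = deg \<alpha> \<and> key \<beta> < key \<alpha>}"
  then obtain \<beta> where \<beta>: "\<beta> \<in> exps" "deg \<beta> = deg \<alpha>" "key \<beta> < key \<alpha>" "s = mon \<beta>" by auto
  let ?\<gamma> = "\<lambda>j. \<beta> j + \<delta> j"
  have eq: "mon \<delta> \<otimes> s = mon ?\<gamma>"
    using \<beta> by (simp add: mon_add m_comm mon_closed)
  have "?\<gamma> \<in> {\<beta> \<in> exps. deg \<beta> = deg (\<lambda>j. \<alpha> j + \<delta> j) \<and> key \<beta> < key (\<lambda>j. \<alpha> j + \<delta> j)}"
    using \<beta> assms(1) exps_add[of \<beta> \<delta>] key_add_less by (auto simp: deg_add)
  then show "mon \<delta> \<otimes> s \<in> lower (\<lambda>j. \<alpha> j + \<delta> j)"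
    unfolding lower_def eq by (rule mon_mem_genideal)
qed

text \<open>Multiplication by the monomial with the difference exponent keeps the coefficient and
  sends the lower tail to a lower tail.\<close>

lemma lead_mono_exp:
  assumes A: "A \<in> submods" and "\<gamma> \<in> exps" and le: "\<And>j. \<alpha> j \<le> \<gamma> j"
  shows "lead A \<alpha> \<subseteq> lead A \<gamma>"
proof
  fix c assume "c \<in> lead A \<alpha>"
  then obtain w where c: "c \<in> carrier R" "w \<in> lower \<alpha>" "c \<otimes> mon \<alpha> \<oplus> w \<in> A (deg \<alpha>)"
    by (auto simp: lead_def)
  define \<delta> where "\<delta> = (\<lambda>j. \<gamma> j - \<alpha> j)"
  have \<delta>: "\<delta> \<in> exps" using assms(2) by (simp add: exps_def \<delta>_def)
  have \<gamma>: "\<gamma> = (\<lambda>j. \<alpha> j + \<delta> j)" using le by (simp add: \<delta>_def)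
  have "mon \<delta> \<otimes> (c \<otimes> mon \<alpha> \<oplus> w) = c \<otimes> mon \<gamma> \<oplus> mon \<delta> \<otimes> w"
    using c ideal.Icarr[OF lower_ideal c(2)] mon_closed by (simp add: \<gamma> mon_add r_distr m_ac)
  moreover have "mon \<delta> \<otimes> (c \<otimes> mon \<alpha> \<oplus> w) \<in> A (deg \<gamma>)"
    using submodsD(3)[OF A, OF \<delta> c(3)] by (simp add: \<gamma> deg_add)
  ultimately have "c \<otimes> mon \<gamma> \<oplus> mon \<delta> \<otimes> w \<in> A (deg \<gamma>)" by simp
  moreover have "mon \<delta> \<otimes> w \<in> lower \<gamma>"
    using mon_mult_lower[OF \<delta> c(2)] by (simp add: \<gamma>)
  ultimately show "c \<in> lead A \<gamma>" using c(1) unfolding lead_def by blast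
qed

text \<open>Reduction modulo \<open>A\<close> cancels the leading monomial, as in division with respect to a
  Groebner basis; it terminates because there are finitely many monomials of each degree.\<close>

lemma lead_eq_imp_subset:
  assumes A: "A \<in> submods" and B: "B \<in> submods" and AB: "\<And>n. A n \<subseteq> B n"
    and lead: "\<And>\<alpha>. \<alpha> \<in> exps \<Longrightarrow> lead B \<alpha> \<subseteq> lead A \<alpha>"
  shows "B n \<subseteq> A n"
proof -
  let ?X = "{\<alpha> \<in> exps. deg \<alpha> = n}"
  \<comment> \<open>Generalised to sets \<open>Y\<close> of monomials of degree \<open>n\<close>
    that are closed downwards under \<open>key\<close>. Removing the largest one, \<alpha>, leaves a
    set of the same kind, which is exactly the generating set of
    \<open>lower \<alpha>\<close>.\<close>
  have "b \<in> A n" if "Y \<subseteq> ?X" "\<And>\<alpha> \<beta>. \<alpha> \<in> Y \<Longrightarrow> \<beta> \<in> ?X \<Longrightarrow> key \<beta> < key \<alpha> \<Longrightarrow> \<beta> \<in> Y"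
    "b \<in> B n" "b \<in> Idl (mon ` Y)" for b Y
    using that
  proof (induction "card Y" arbitrary: b Y rule: less_induct)
    case less
    have fin: "finite Y" using finite_subset[OF less.prems(1) finite_exps_deg] .
    show ?case
    proof (cases "Y = {}")
      case True
      have "Idl {} \<subseteq> {\<zero>}" by (rule genideal_minimal[OF zeroideal]) auto
      then have "b = \<zero>" using less.prems(4) True by auto
      then show ?thesis using ideal_zero_mem[OF submodsD(1)[OF A]] by simp
    next
      case False
      have "Max (key ` Y) \<in> key ` Y" using fin False by simp
      then obtain \<alpha> where \<alpha>: "\<alpha> \<in> Y" "key \<alpha> = Max (key ` Y)" by auto
      have max: "key \<beta> \<le> key \<alpha>" if "\<beta> \<in> Y" for \<beta> using that fin \<alpha>(2) by simp
      have \<alpha>X: "\<alpha> \<in> exps" "deg \<alpha> = n" using less.prems(1) \<alpha>(1) by auto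
      define Y' where "Y' = {\<beta> \<in> exps. deg \<beta> = n \<and> key \<beta> < key \<alpha>}"
      have Y: "Y = insert \<alpha> Y'"
      proof
        show "insert \<alpha> Y' \<subseteq> Y" using less.prems(2)[OF \<alpha>(1)] \<alpha>(1) by (auto simp: Y'_def)
        show "Y \<subseteq> insert \<alpha> Y'"
        proof
          fix \<beta> assume \<beta>: "\<beta> \<in> Y"
          then have \<beta>X: "\<beta> \<in> exps" "deg \<beta> = n" using less.prems(1) by auto
          show "\<beta> \<in> insert \<alpha> Y'"
          proof (cases "key \<beta> = key \<alpha>")
            case True
            then show ?thesis using inj_onD[OF key_inj] \<beta>X \<alpha>X by auto
          next
            case False
            then show ?thesis using max[OF \<beta>] \<beta>X by (simp add: Y'_def less_le)
          qed
        qed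
      qed
      have low: "lower \<alpha> = Idl (mon ` Y')" by (simp add: lower_def Y'_def \<alpha>X)
      obtain c w where cw: "c \<in> carrier R" "w \<in> lower \<alpha>" "b = c \<otimes> mon \<alpha> \<oplus> w"
        using genideal_insert_mem[OF mon_closed mon_image_closed, of b \<alpha> Y'] less.prems(4)
        unfolding low by (auto simp: Y)
      have "c \<in> lead B \<alpha>" using cw less.prems(3) \<alpha>X by (auto simp: lead_def)
      then obtain v where v: "v \<in> lower \<alpha>" "c \<otimes> mon \<alpha> \<oplus> v \<in> A n"
        using lead[OF \<alpha>X(1)] \<alpha>X by (auto simp: lead_def)
      have carr: "w \<in> carrier R" "v \<in> carrier R" "c \<otimes> mon \<alpha> \<in> carrier R"
        using cw v ideal.Icarr[OF lower_ideal] mon_closed by auto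
      let ?a = "c \<otimes> mon \<alpha> \<oplus> v"
      \<comment> \<open>Both elements have the leading term \<open>c \<otimes> mon \<alpha>\<close>,
        so only the lower tails survive in the difference.\<close>
      have diff: "b \<ominus> ?a = w \<ominus> v"
        using carr unfolding cw(3) by algebra
      have "b \<ominus> ?a \<in> A n"
      proof (rule less.hyps[of Y'])
        have "\<alpha> \<notin> Y'" by (simp add: Y'_def)
        then show "card Y' < card Y" using fin by (simp add: Y)
        show "Y' \<subseteq> ?X" by (auto simp: Y'_def)
        show "\<beta> \<in> Y'" if "\<gamma> \<in> Y'" "\<beta> \<in> ?X" "key \<beta> < key \<gamma>" for \<gamma> \<beta>
          using that by (auto simp: Y'_def)
        show "b \<ominus> ?a \<in> B n"
          using ideal_minus_mem[OF submodsD(1)[OF B] less.prems(3)] v(2) AB by auto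
        show "b \<ominus> ?a \<in> Idl (mon ` Y')"
          unfolding diff low[symmetric] using ideal_minus_mem[OF lower_ideal cw(2) v(1)] .
      qed
      then have "(b \<ominus> ?a) \<oplus> ?a \<in> A n" using ideal_add_mem[OF submodsD(1)[OF A]] v(2) by auto
      moreover have "(b \<ominus> ?a) \<oplus> ?a = b" using carr unfolding cw(3) by algebra
      ultimately show ?thesis by simp
    qed
  qed
  from this[of ?X] show ?thesis using submodsD(2)[OF B] unfolding rees_def by auto
qed

text \<open>If every step were strict, each would enlarge \<open>lead\<close> at some exponent.
  Along a subsequence on which these exponents increase componentwise, the leading coefficient
  ideals ascend strictly, against Noetherianity of \<open>R\<close>.\<close>

lemma submods_acc:
  assumes F: "\<And>k::nat. F k \<in> submods" and mono: "\<And>k n. F k n \<subseteq> F (Suc k) n"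
  shows "\<exists>k. F (Suc k) = F k"
proof (rule ccontr)
  assume neq: "\<not> ?thesis"
  have "\<exists>\<alpha>\<in>exps. \<not> lead (F (Suc k)) \<alpha> \<subseteq> lead (F k) \<alpha>" for k
  proof (rule ccontr)
    assume "\<not> ?thesis"
    then have "F (Suc k) n \<subseteq> F k n" for n
      using lead_eq_imp_subset[OF F F mono] by blast
    then have "F (Suc k) = F k" using mono by blast
    with neq show False by blast
  qed
  then obtain \<alpha> where \<alpha>: "\<And>k. \<alpha> k \<in> exps" "\<And>k. \<not> lead (F (Suc k)) (\<alpha> k) \<subseteq> lead (F k) (\<alpha> k)"
    by metis
  obtain f :: "nat \<Rightarrow> nat" where f: "strict_mono f" "\<And>j. j < N \<Longrightarrow> mono (\<lambda>k. \<alpha> (f k) j)"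
    using dickson_subseq[of N \<alpha>] by blast
  have Fle: "F k n \<subseteq> F l n" if "k \<le> l" for k l n
    using lift_Suc_mono_le[of "\<lambda>k. F k n", OF mono that] .
  define H where "H k = lead (F (f k)) (\<alpha> (f k))" for k
  \<comment> \<open>Together with \<open>sub\<close> below, this places between \<open>H k\<close>
    and \<open>H (Suc k)\<close> an ideal that is strictly larger than \<open>H k\<close> by the
    choice of \<alpha>.\<close>
  have step: "lead (F (Suc (f k))) (\<alpha> (f k)) \<subseteq> H (Suc k)" for k
  proof -
    have "Suc (f k) \<le> f (Suc k)" using f(1) by (simp add: strict_mono_Suc_iff Suc_leI)
    then have "lead (F (Suc (f k))) (\<alpha> (f k)) \<subseteq> lead (F (f (Suc k))) (\<alpha> (f k))"
      by (intro lead_mono_family Fle)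
    also have "\<dots> \<subseteq> H (Suc k)"
      unfolding H_def
    proof (rule lead_mono_exp[OF F \<alpha>(1)])
      fix j
      show "\<alpha> (f k) j \<le> \<alpha> (f (Suc k)) j"
        \<comment> \<open>Dickson's lemma controls only the coordinates below \<open>N\<close>; the
          others vanish.\<close>
        using monoD[OF f(2), of j k "Suc k"] \<alpha>(1)[of "f k"] by (cases "j < N") (auto simp: exps_def)
    qed
    finally show ?thesis .
  qed
  have sub: "H k \<subseteq> lead (F (Suc (f k))) (\<alpha> (f k))" for k
    unfolding H_def by (rule lead_mono_family[OF mono])
  obtain k where "H (Suc k) = H k"
    using ideal_seq_stationary[of H] lead_ideal[OF F] sub step unfolding H_def by blast
  then show False using \<alpha>(2)[of "f k"] step[of k] by (auto simp: H_def)
qed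

section \<open>The Rees algebra as a Noetherian family\<close>

lemma submods_add:
  assumes A: "A \<in> submods" and x: "x \<in> carrier R"
  shows "(\<lambda>n. {a \<oplus> x \<otimes> m | a m. a \<in> A n \<and> m \<in> rees n}) \<in> submods"
proof -
  note Ai = submodsD(1)[OF A] and As = submodsD(2)[OF A]
  have mc: "m \<in> carrier R" if "m \<in> rees n" for m n using ideal.Icarr[OF rees_ideal that] .
  have ac: "a \<in> carrier R" if "a \<in> A n" for a n using ideal.Icarr[OF Ai that] .
  let ?S = "\<lambda>n. {a \<oplus> x \<otimes> m | a m. a \<in> A n \<and> m \<in> rees n}"
  have 1: "ideal (?S n) R" for n
  proof (rule ideal_by_closure)
    show "?S n \<subseteq> carrier R" using mc ac x by auto
    have "\<zero> = \<zero> \<oplus> x \<otimes> \<zero>" using x by simp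
    then show "\<zero> \<in> ?S n" using ideal_zero_mem[OF Ai] ideal_zero_mem[OF rees_ideal] by blast
  next
    fix y z assume "y \<in> ?S n" "z \<in> ?S n"
    then obtain a m b l where *: "a \<in> A n" "m \<in> rees n" "y = a \<oplus> x \<otimes> m"
      "b \<in> A n" "l \<in> rees n" "z = b \<oplus> x \<otimes> l" by auto
    have "y \<oplus> z = (a \<oplus> b) \<oplus> x \<otimes> (m \<oplus> l)"
      using * mc ac x by (simp add: r_distr a_ac)
    then show "y \<oplus> z \<in> ?S n" using * ideal_add_mem[OF Ai] ideal_add_mem[OF rees_ideal] by blast
  next
    fix y z assume "y \<in> ?S n" and z: "z \<in> carrier R"
    then obtain a m where *: "a \<in> A n" "m \<in> rees n" "y = a \<oplus> x \<otimes> m" by auto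
    have "z \<otimes> y = z \<otimes> a \<oplus> x \<otimes> (z \<otimes> m)"
      using * mc ac x z by (simp add: r_distr m_lcomm)
    then show "z \<otimes> y \<in> ?S n"
      using * ideal.I_l_closed[OF Ai _ z] ideal.I_l_closed[OF rees_ideal _ z] by blast
  qed
  have 2: "?S n \<subseteq> rees n" for n
    using subsetD[OF As] ideal_add_mem[OF rees_ideal] ideal.I_l_closed[OF rees_ideal _ x] by auto
  have 3: "mon \<alpha> \<otimes> y \<in> ?S (\<lambda>i. n i + deg \<alpha> i)" if \<alpha>: "\<alpha> \<in> exps" and y: "y \<in> ?S n" for \<alpha> y n
  proof -
    from y obtain a m where *: "a \<in> A n" "m \<in> rees n" "y = a \<oplus> x \<otimes> m" by auto
    have "mon \<alpha> \<otimes> y = mon \<alpha> \<otimes> a \<oplus> x \<otimes> (mon \<alpha> \<otimes> m)"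
      using * mc ac x mon_closed by (simp add: r_distr m_lcomm)
    with submodsD(3)[OF A, OF \<alpha> *(1)] mon_mult_rees[OF \<alpha> *(2)] show ?thesis
      unfolding mem_Collect_eq
      by (intro exI[of _ "mon \<alpha> \<otimes> a"] exI[of _ "mon \<alpha> \<otimes> m"] conjI)
  qed
  show ?thesis by (rule submodsI[of ?S]) (rule 1, rule 2, rule 3)
qed

lemma submods_colon:
  assumes A: "A \<in> submods" and X: "X \<subseteq> carrier R"
  shows "(\<lambda>n. {m \<in> rees n. \<forall>x\<in>X. x \<otimes> m \<in> A n}) \<in> submods"
proof -
  note Ai = submodsD(1)[OF A]
  have mc: "m \<in> carrier R" if "m \<in> rees n" for m n using ideal.Icarr[OF rees_ideal that] .
  have xc: "x \<in> carrier R" if "x \<in> X" for x using X that by auto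
  let ?S = "\<lambda>n. {m \<in> rees n. \<forall>x\<in>X. x \<otimes> m \<in> A n}"
  have 1: "ideal (?S n) R" for n
  proof (rule ideal_by_closure)
    show "?S n \<subseteq> carrier R" using mc by auto
    show "\<zero> \<in> ?S n" using ideal_zero_mem[OF Ai] ideal_zero_mem[OF rees_ideal] xc by auto
  next
    fix y z assume "y \<in> ?S n" "z \<in> ?S n"
    then show "y \<oplus> z \<in> ?S n"
      using ideal_add_mem[OF Ai] ideal_add_mem[OF rees_ideal]
      by (auto simp: r_distr[OF mc mc xc])
  next
    fix y z assume y: "y \<in> ?S n" and z: "z \<in> carrier R"
    have "x \<otimes> (z \<otimes> y) = z \<otimes> (x \<otimes> y)" if "x \<in> X" for x
      using m_lcomm[OF xc[OF that] z] mc y by blast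
    then show "z \<otimes> y \<in> ?S n"
      using y ideal.I_l_closed[OF Ai _ z] ideal.I_l_closed[OF rees_ideal _ z] by auto
  qed
  have 3: "mon \<alpha> \<otimes> y \<in> ?S (\<lambda>i. n i + deg \<alpha> i)" if \<alpha>: "\<alpha> \<in> exps" and y: "y \<in> ?S n" for \<alpha> y n
  proof -
    have "x \<otimes> (mon \<alpha> \<otimes> y) = mon \<alpha> \<otimes> (x \<otimes> y)" if "x \<in> X" for x
      using m_lcomm[OF xc[OF that] mon_closed] mc y by blast
    then show ?thesis using submodsD(3)[OF A, OF \<alpha>] mon_mult_rees[OF \<alpha>] y by simp
  qed
  show ?thesis by (rule submodsI[of ?S]) (rule 1, blast, rule 3)
qed

sublocale rees: noetherian_families R rees submods
  apply (rule noetherian_families.intro)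
   apply (rule noetherian_cring_axioms)
  apply (rule noetherian_families_axioms.intro)
  subgoal by (rule rees_ideal)
  subgoal for A n by (rule submodsD(1)[of A n])
  subgoal for A n by (rule submodsD(2)[of A n])
  subgoal for A x by (rule submods_add[of A x])
  subgoal for A X by (rule submods_colon[of A X])
  subgoal for F by (rule submods_acc[of F])
  done

section \<open>Rees components as products of ideal powers\<close>

lemma rees_zero: "rees (\<lambda>_. 0) = carrier R"
proof (rule ideal.one_imp_carrier[OF rees_ideal])
  show "\<one> \<in> rees (\<lambda>_. 0)"
    using mon_mem_rees[of "\<lambda>_. 0"] by (simp add: mon_zero exps_def deg_def)
qed

text \<open>A monomial whose degree is positive at \<open>i\<close> contains a generator
  \<open>g j\<close> with \<open>d j = i\<close>, which can be split off; conversely, multiplying by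
  such a generator raises the degree by one at \<open>i\<close>.\<close>

lemma rees_step:
  "rees (n(i := Suc (n i))) = ideal_prod R (Idl (g ` {j. j < N \<and> d j = i})) (rees n)"
    (is "?L = ideal_prod R ?I _")
proof
  have gc: "g ` {j. j < N \<and> d j = i} \<subseteq> carrier R" using g_closed by auto
  have Ii: "ideal ?I R" by (rule genideal_ideal[OF gc])
  show "?L \<subseteq> ideal_prod R ?I (rees n)"
    unfolding rees_def[of "n(i := Suc (n i))"]
  proof (rule genideal_minimal[OF ideal_prod_is_ideal[OF Ii rees_ideal]], rule subsetI)
    fix s assume "s \<in> mon ` {\<alpha> \<in> exps. deg \<alpha> = n(i := Suc (n i))}"
    then obtain \<beta> where \<beta>: "\<beta> \<in> exps" "deg \<beta> = n(i := Suc (n i))" "s = mon \<beta>" by auto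
    have "(\<Sum>j<N. if d j = i then \<beta> j else 0) \<noteq> 0"
      using fun_cong[OF \<beta>(2), of i] by (simp add: deg_def)
    then obtain j where "j \<in> {..<N}" "(if d j = i then \<beta> j else 0) \<noteq> 0"
      by (rule sum.not_neutral_contains_not_neutral)
    then have j: "j < N" "d j = i" "\<beta> j \<noteq> 0" by (auto split: if_splits)
    let ?u = "\<lambda>k. if k = j then 1 else (0::nat)"
    define \<gamma> where "\<gamma> = (\<lambda>k. \<beta> k - ?u k)"
    have eq: "\<beta> = (\<lambda>k. ?u k + \<gamma> k)" using j by (auto simp: \<gamma>_def)
    have \<gamma>: "\<gamma> \<in> exps" using \<beta>(1) by (auto simp: exps_def \<gamma>_def)
    have "deg \<gamma> = n"
    proof
      fix l
      have "deg \<beta> l = (if l = i then 1 else 0) + deg \<gamma> l"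
        using deg_unit[OF j(1)] j(2) by (subst eq) (simp add: deg_add)
      then show "deg \<gamma> l = n l" using \<beta>(2) by (auto split: if_splits)
    qed
    then have "mon \<gamma> \<in> rees n" using mon_mem_rees[OF \<gamma>] by simp
    moreover have "g j \<in> ?I" using genideal_self[OF gc] j by auto
    moreover have "s = g j \<otimes> mon \<gamma>"
      unfolding \<beta>(3) by (subst eq) (simp add: mon_add mon_unit[OF j(1)])
    ultimately show "s \<in> ideal_prod R ?I (rees n)" by (simp add: ideal_prod.prod)
  qed
  show "ideal_prod R ?I (rees n) \<subseteq> ?L"
  proof
    fix z assume "z \<in> ideal_prod R ?I (rees n)"
    then show "z \<in> ?L"
    proof (induction rule: ideal_prod.induct)
      case (prod x y)
      have yc: "y \<in> carrier R" using ideal.Icarr[OF rees_ideal prod(2)] .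
      have "y \<otimes> x \<in> ?L"
      proof (rule genideal_mult_mem[OF gc rees_ideal yc _ prod(1)])
        fix s assume "s \<in> g ` {j. j < N \<and> d j = i}"
        then obtain j where j: "j < N" "d j = i" "s = g j" by auto
        have "(\<lambda>l. n l + (if l = d j then 1 else 0)) = n(i := Suc (n i))" using j by auto
        then have "g j \<otimes> y \<in> ?L"
          using mon_mult_rees[OF exps_unit[OF j(1)] prod(2)] mon_unit[OF j(1)] deg_unit[OF j(1)]
          by simp
        then show "y \<otimes> s \<in> ?L" using j yc g_closed by (simp add: m_comm)
      qed
      then show ?case unfolding m_comm[OF yc ideal.Icarr[OF Ii prod(1)]] .
    next
      case (sum s t)
      show ?case by (rule ideal_add_mem[OF rees_ideal sum.IH])
    qed
  qed
qed

lemma rees_step_subset: "rees (n(i := Suc (n i))) \<subseteq> rees n"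
proof -
  have "ideal (Idl (g ` {j. j < N \<and> d j = i})) R" by (rule genideal_ideal) (use g_closed in auto)
  then show ?thesis unfolding rees_step using ideal_prod_inter[OF _ rees_ideal] by blast
qed

text \<open>The submodule to which \<open>uniform_colon\<close> will be applied; raising the degree
  at \<open>i\<close> commutes with adding the degree of a monomial.\<close>

lemma rees_shift_submod: "(\<lambda>n. rees (n(i := Suc (n i)))) \<in> submods"
proof (rule submodsI)
  fix \<alpha> x n assume *: "\<alpha> \<in> exps" "x \<in> rees (n(i := Suc (n i)))"
  have "(\<lambda>l. (n(i := Suc (n i))) l + deg \<alpha> l) = (\<lambda>l. n l + deg \<alpha> l)(i := Suc (n i + deg \<alpha> i))"
    by auto
  then show "mon \<alpha> \<otimes> x \<in> rees ((\<lambda>l. n l + deg \<alpha> l)(i := Suc (n i + deg \<alpha> i)))"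
    using mon_mult_rees[OF *] by simp
qed (rule rees_ideal, rule rees_step_subset)

lemma ideal_pow_mult_rees:
  assumes "I = Idl (g ` {j. j < N \<and> d j = i})"
  shows "ideal_prod R (ideal_pow R I k) (rees n) = rees (n(i := n i + k))"
proof (induction k)
  case 0
  then show ?case
    by (simp add: ideal_prod_commute[OF oneideal rees_ideal] ideal_prod_one rees_ideal)
next
  case (Suc k)
  have I: "ideal I R" unfolding assms by (rule genideal_ideal) (use g_closed in auto)
  have "ideal_prod R (ideal_pow R I (Suc k)) (rees n)
      = ideal_prod R I (ideal_prod R (ideal_pow R I k) (rees n))"
    using I by (simp add: ideal_prod_assoc ideal_pow_ideal rees_ideal)
  also have "\<dots> = ideal_prod R I (rees (n(i := n i + k)))" unfolding Suc.IH ..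
  also have "\<dots> = rees (n(i := n i + Suc k))"
    unfolding assms rees_step[symmetric] by simp
  finally show ?case .
qed

text \<open>Each further ideal power raises one coordinate of the degree from zero to
  \<open>n r\<close>. Coordinates from \<open>r\<close> on are set to zero because the product does
  not see them.\<close>

lemma ideal_prod_pows_eq_rees:
  assumes "\<And>i. i < r \<Longrightarrow> I i = Idl (g ` {j. j < N \<and> d j = i})"
  shows "ideal_prod_pows R I n r = rees (\<lambda>i. if i < r then n i else 0)"
  using assms
proof (induction r)
  case 0
  then show ?case by (simp add: rees_zero)
next
  case (Suc r)
  have I: "ideal (I r) R"
    unfolding Suc.prems[OF lessI] by (rule genideal_ideal) (use g_closed in auto)
  let ?m = "\<lambda>i. if i < r then n i else 0"
  have IH: "ideal_prod_pows R I n r = rees ?m" by (rule Suc.IH) (rule Suc.prems, simp)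
  have "ideal_prod_pows R I n (Suc r) = ideal_prod R (ideal_pow R (I r) (n r)) (rees ?m)"
    unfolding ideal_prod_pows.simps IH
    by (rule ideal_prod_commute[OF rees_ideal ideal_pow_ideal[OF I]])
  also have "\<dots> = rees (?m(r := ?m r + n r))"
    by (rule ideal_pow_mult_rees) (rule Suc.prems[OF lessI])
  also have "?m(r := ?m r + n r) = (\<lambda>i. if i < Suc r then n i else 0)" by auto
  finally show ?case .
qed

text \<open>Induction on the total degree. Lower \<open>n\<close> by one at some \<open>i\<close> to
  get \<open>m\<close>: the first \<open>C * k\<close> factors of \<open>J\<close> bring
  \<open>y\<close> into \<open>rees m\<close> by induction, and \<open>uniform_colon\<close> for the
  shift at \<open>i\<close> lets \<open>C\<close> more bring it into \<open>rees n\<close>.\<close>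

theorem rees_colon_linear:
  fixes r :: nat
  shows "\<exists>c. \<forall>J n e y. ideal J R \<longrightarrow> (\<forall>i\<ge>r. n i = 0) \<longrightarrow> y \<in> carrier R
    \<longrightarrow> (\<forall>z\<in>ideal_pow R J e. y \<otimes> z \<in> rees n)
    \<longrightarrow> (\<forall>z\<in>ideal_pow R J (c * (\<Sum>i<r. n i)). y \<otimes> z \<in> rees n)"
proof -
  have "\<exists>c. \<forall>J e n. \<forall>y\<in>rees n. ideal J R
      \<longrightarrow> (\<forall>z\<in>ideal_pow R J e. y \<otimes> z \<in> rees (n(i := Suc (n i))))
      \<longrightarrow> (\<forall>z\<in>ideal_pow R J c. y \<otimes> z \<in> rees (n(i := Suc (n i))))" for i
    using rees.uniform_colon[OF rees_shift_submod] .
  then obtain c where c: "\<And>i J e n y. y \<in> rees n \<Longrightarrow> ideal J R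
      \<Longrightarrow> (\<forall>z\<in>ideal_pow R J e. y \<otimes> z \<in> rees (n(i := Suc (n i))))
      \<Longrightarrow> (\<forall>z\<in>ideal_pow R J (c i). y \<otimes> z \<in> rees (n(i := Suc (n i))))"
    by metis
  \<comment> \<open>The sum is a common bound for the constants of the finitely many directions
    \<open>i < r\<close>.\<close>
  define C where "C = (\<Sum>i<r. c i)"
  have main: "y \<otimes> z \<in> rees n"
    if J: "ideal J R" and "\<forall>i\<ge>r. n i = 0" "y \<in> carrier R"
      "\<forall>z\<in>ideal_pow R J e. y \<otimes> z \<in> rees n" "z \<in> ideal_pow R J (C * k)" "k = (\<Sum>i<r. n i)"
    for J n e y z k
    using that(2-)
  proof (induction k arbitrary: n z)
    case 0
    then have "n i = 0" for i by (cases "i < r") auto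
    then have "n = (\<lambda>_. 0)" by auto
    then have "rees n = carrier R" using rees_zero by simp
    then show ?case using 0 ideal.Icarr[OF ideal_pow_ideal[OF J]] by blast
  next
    case (Suc k)
    have "(\<Sum>i<r. n i) \<noteq> 0" unfolding Suc.prems(5)[symmetric] by simp
    then obtain i where "i \<in> {..<r}" "n i \<noteq> 0"
      by (rule sum.not_neutral_contains_not_neutral)
    then have i: "i < r" "n i \<noteq> 0" by auto
    define m where "m = n(i := n i - 1)"
    have n: "n = m(i := Suc (m i))" using i by (auto simp: m_def)
    have "(\<Sum>i<r. n i) = n i + sum n ({..<r} - {i})" "(\<Sum>i<r. m i) = m i + sum m ({..<r} - {i})"
      using i by (simp_all add: sum.remove)
    moreover have "sum n ({..<r} - {i}) = sum m ({..<r} - {i})"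
      by (rule sum.cong) (auto simp: m_def)
    moreover have "n i = Suc (m i)" using i by (simp add: m_def)
    ultimately have k: "k = (\<Sum>i<r. m i)" using Suc.prems(5) by linarith
    have sub: "rees n \<subseteq> rees m" unfolding n by (rule rees_step_subset)
    have Ci: "c i \<le> C" unfolding C_def using i by (intro member_le_sum) auto
    have Jk: "ideal (ideal_pow R J l) R" for l by (rule ideal_pow_ideal[OF J])
    have "ideal_pow R J (C * Suc k) = ideal_prod R (ideal_pow R J (C * k)) (ideal_pow R J C)"
      using ideal_pow_add[OF J, of "C * k" C] by (simp add: add.commute)
    then have z: "z \<in> ideal_prod R (ideal_pow R J (C * k)) (ideal_pow R J C)"
      using Suc.prems(4) by simp
    show ?case
    proof (rule mult_ideal_prod_mem[OF Jk Jk rees_ideal Suc.prems(2) _ z])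
      fix u v assume u: "u \<in> ideal_pow R J (C * k)" and v: "v \<in> ideal_pow R J C"
      have uc: "u \<in> carrier R" and vc: "v \<in> carrier R" using ideal.Icarr[OF Jk] u v by auto
      have "\<forall>i\<ge>r. m i = 0" using Suc.prems(1) by (simp add: m_def)
      then have yu: "y \<otimes> u \<in> rees m"
        using Suc.IH[OF _ Suc.prems(2) _ u k] Suc.prems(3) sub by blast
      \<comment> \<open>The hypothesis with exponent \<open>e\<close> passes from \<open>y\<close>
        to its multiple by \<open>u\<close>, as \<open>uniform_colon\<close> requires.\<close>
      have "(y \<otimes> u) \<otimes> w \<in> rees n" if w: "w \<in> ideal_pow R J e" for w
      proof -
        have wc: "w \<in> carrier R" using ideal.Icarr[OF Jk w] .
        have "(y \<otimes> u) \<otimes> w = u \<otimes> (y \<otimes> w)"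
          using uc wc Suc.prems(2) by (simp add: m_ac)
        then show ?thesis using ideal.I_l_closed[OF rees_ideal _ uc] Suc.prems(3) w by simp
      qed
      then have "\<forall>w\<in>ideal_pow R J (c i). (y \<otimes> u) \<otimes> w \<in> rees n"
        using c[OF yu J, where i = i and e = e] unfolding n[symmetric] by blast
      moreover have "v \<in> ideal_pow R J (c i)" using v ideal_pow_antimono[OF J Ci] by blast
      ultimately show "y \<otimes> (u \<otimes> v) \<in> rees n"
        unfolding m_assoc[OF Suc.prems(2) uc vc, symmetric] by blast
    qed
  qed
  show ?thesis by (intro exI[of _ C] allI impI ballI) (rule main[OF _ _ _ _ _ refl])
qed

end

section \<open>Transfer to arbitrary ideals of a Noetherian ring\<close>

lemma (in noetherian_cring) finite_graded_generators:
  fixes I :: "nat \<Rightarrow> 'a set"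
  assumes "\<And>i. i < r \<Longrightarrow> ideal (I i) R"
  shows "\<exists>N g d. (\<forall>j<(N::nat). g j \<in> carrier R) \<and>
    (\<forall>i<r. I i = Idl (g ` {j. j < N \<and> d j = i}))"
proof -
  have "\<exists>S. \<forall>i<r. S i \<subseteq> carrier R \<and> finite (S i) \<and> I i = Idl (S i)"
    using finetely_gen[OF assms] by metis
  then obtain S where S: "\<And>i. i < r \<Longrightarrow> S i \<subseteq> carrier R"
    "\<And>i. i < r \<Longrightarrow> finite (S i)" "\<And>i. i < r \<Longrightarrow> I i = Idl (S i)" by blast
  \<comment> \<open>Generators are tagged with the index of their ideal, so an element used for
    several ideals occurs once for each; \<open>g\<close> and \<open>d\<close> are the projections
    of the listed pairs.\<close>
  have "finite (Sigma {..<r} S)" using S(2) by auto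
  then obtain xs where xs: "set xs = Sigma {..<r} S" using finite_list by blast
  let ?g = "\<lambda>j. snd (xs ! j)" and ?d = "\<lambda>j. fst (xs ! j)"
  have 1: "?g j \<in> carrier R" if "j < length xs" for j
  proof -
    have "xs ! j \<in> Sigma {..<r} S" using that xs nth_mem by blast
    then show ?thesis using S(1)[of "fst (xs ! j)"] by auto
  qed
  have 2: "I i = Idl (?g ` {j. j < length xs \<and> ?d j = i})" if i: "i < r" for i
  proof -
    have "?g ` {j. j < length xs \<and> ?d j = i} = snd ` {p \<in> set xs. fst p = i}"
      by (auto simp: set_conv_nth image_iff)
    also have "\<dots> = S i" using i by (force simp: xs)
    finally show ?thesis using S(3)[OF i] by simp
  qed
  show ?thesis
    by (intro exI[of _ "length xs"] exI[of _ ?g] exI[of _ ?d] conjI allI impI) (rule 1, assumption, rule 2)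
qed

theorem theorem7p1:
  fixes R :: "('a, 'b) ring_scheme" and I :: "nat \<Rightarrow> 'a set" and r :: nat
  assumes "cring R" and "noetherian_ring R"
    and "\<And>i. i < r \<Longrightarrow> ideal (I i) R"
  shows "\<exists>\<alpha>::nat. \<forall>J (n :: nat \<Rightarrow> nat). ideal J R \<longrightarrow>
           ideal_colon R (ideal_prod_pows R I n r) (ideal_pow R J (\<alpha> * (\<Sum>i<r. n i)))
         = ideal_colon R (ideal_prod_pows R I n r) (ideal_pow R J (\<alpha> * (\<Sum>i<r. n i) + 1))"
proof -
  interpret cring R by fact
  interpret noetherian_ring R by fact
  interpret noetherian_cring R by unfold_locales
  have "\<exists>N g d. (\<forall>j<(N::nat). g j \<in> carrier R) \<and>
      (\<forall>i<r. I i = Idl\<^bsub>R\<^esub> (g ` {j. j < N \<and> d j = i}))"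
    by (rule finite_graded_generators) (rule assms(3))
  then obtain N g d where gens: "(\<forall>j<(N::nat). g j \<in> carrier R) \<and>
      (\<forall>i<r. I i = Idl\<^bsub>R\<^esub> (g ` {j. j < N \<and> d j = i}))"
    by (elim exE)
  then have g: "g j \<in> carrier R" if "j < N" for j using that by blast
  from gens have I: "I i = Idl\<^bsub>R\<^esub> (g ` {j. j < N \<and> d j = i})" if "i < r" for i
    using that by blast
  interpret graded_generators R N g d by unfold_locales (rule g)
  obtain c where "\<forall>J n e y. ideal J R \<longrightarrow> (\<forall>i\<ge>r. n i = 0) \<longrightarrow> y \<in> carrier R
    \<longrightarrow> (\<forall>z\<in>ideal_pow R J e. y \<otimes>\<^bsub>R\<^esub> z \<in> rees n)
    \<longrightarrow> (\<forall>z\<in>ideal_pow R J (c * (\<Sum>i<r. n i)). y \<otimes>\<^bsub>R\<^esub> z \<in> rees n)"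
    using rees_colon_linear[of r] ..
  then have c: "\<forall>z\<in>ideal_pow R J (c * (\<Sum>i<r. n i)). y \<otimes>\<^bsub>R\<^esub> z \<in> rees n"
    if "ideal J R" "\<forall>i\<ge>r. n i = 0" "y \<in> carrier R"
      "\<forall>z\<in>ideal_pow R J e. y \<otimes>\<^bsub>R\<^esub> z \<in> rees n" for J n e y
    using that by blast
  show ?thesis
  proof (intro exI[of _ c] allI impI equalityI)
    fix J n assume J: "ideal J R"
    \<comment> \<open>The given \<open>n\<close> is arbitrary from \<open>r\<close> on, whereas
      \<open>rees\<close> reads all coordinates; truncation meets the vanishing condition of
      \<open>c\<close> and keeps the sum.\<close>
    let ?n = "\<lambda>i. if i < r then n i else 0" and ?s = "c * (\<Sum>i<r. n i)"
    have P: "ideal_prod_pows R I n r = rees ?n" by (rule ideal_prod_pows_eq_rees) (rule I)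
    have s: "(\<Sum>i<r. ?n i) = (\<Sum>i<r. n i)" by (rule sum.cong) auto
    show "ideal_colon R (ideal_prod_pows R I n r) (ideal_pow R J ?s)
        \<subseteq> ideal_colon R (ideal_prod_pows R I n r) (ideal_pow R J (?s + 1))"
      unfolding ideal_colon_def using ideal_pow_antimono[OF J, of ?s "?s + 1"] by auto
    show "ideal_colon R (ideal_prod_pows R I n r) (ideal_pow R J (?s + 1))
        \<subseteq> ideal_colon R (ideal_prod_pows R I n r) (ideal_pow R J ?s)"
    proof
      fix y assume "y \<in> ideal_colon R (ideal_prod_pows R I n r) (ideal_pow R J (?s + 1))"
      then have y: "y \<in> carrier R" "\<forall>z\<in>ideal_pow R J (?s + 1). y \<otimes>\<^bsub>R\<^esub> z \<in> rees ?n"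
        unfolding ideal_colon_def P by auto
      \<comment> \<open>Here the free exponent \<open>e\<close> is taken to be
        \<open>?s + 1\<close>.\<close>
      have "\<forall>z\<in>ideal_pow R J ?s. y \<otimes>\<^bsub>R\<^esub> z \<in> rees ?n"
        using c[OF J _ y] unfolding s by simp
      then show "y \<in> ideal_colon R (ideal_prod_pows R I n r) (ideal_pow R J ?s)"
        unfolding ideal_colon_def P using y(1) by blast
    qed
  qed
qed

end
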